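(* Let $\mathcal{P}$ be a convex set of Borel probability measures on a Polish space $\Omega$, let $S_0\in\mathbb{R}^d$, let $S_1:\Omega\to\mathbb{R}^d$ be Borel measurable, $\Delta S:=S_1-S_0$, and let $\mathcal{H}\subset\mathbb{R}^d$. Assume that the cone $\mathcal{C}_{\mathcal{H}}(\mathcal{P})$ is convex and closed. Then NA$(\mathcal{P})$ holds if and only if for every $P\in\mathcal{P}$ there exists $Q\in\mathcal{Q}$ dominating $P$ (i.e. $P\ll Q$), where $$\mathcal{Q}:=\{Q\in\mathfrak{P}(\Omega):\ Q\lll\mathcal{P},\ E_Q|\Delta S|<\infty\text{ and }E_Q[H\Delta S]\le 0\ \ \forall H\in\mathcal{H}\}.$$
   Context: $\mathfrak{P}(\Omega)$ is the set of Borel probability measures on $\Omega$. $H\Delta S$ is the Euclidean inner product. A property holds $\mathcal{P}$-q.s. if it holds $P$-a.s. for every $P\in\mathcal{P}$. $Q\lll\mathcal{P}$ means $Q\ll P$ for some $P\in\mathcal{P}$. NA$(\mathcal{P})$: for every $H\in\mathcal{H}$, if $H\Delta S\ge 0$ $\mathcal{P}$-q.s. then $H\Delta S=0$ $\mathcal{P}$-q.s. ($\mathcal{H}$ is the set of admissible trading strategies.) $\mathrm{supp}_{\mathcal{P}}(\Delta S)$ is the smallest closed $A\subset\mathbb{R}^d$ with $\Delta S\in A$ $\mathcal{P}$-q.s.; $N^\perp(\mathcal{P}):=\mathrm{span}(\mathrm{supp}_{\mathcal{P}}(\Delta S))\subset\mathbb{R}^d$, which is the orthogonal complement of $N(\mathcal{P}):=\{H\in\mathbb{R}^d: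 H\Delta S=0\ \mathcal{P}\text{-q.s.}\}$. $\mathcal{H}(\mathcal{P})$ is the orthogonal projection of $\mathcal{H}$ onto $N^\perp(\mathcal{P})$, and $\mathcal{C}_{\mathcal{H}}(\mathcal{P}):=\{cH: H\in\mathcal{H}(\mathcal{P}),\ c\ge 0\}$. *)

theory Defs
  imports "HOL-Probability.Probability"
begin

abbreviation borel_prob_measures :: "'a::topological_space measure set" where
  "borel_prob_measures \<equiv> space (prob_algebra borel)"

definition mixture :: "real \<Rightarrow> 'a measure \<Rightarrow> 'a measure \<Rightarrow> 'a measure" where
  "mixture u P Q = measure_of (space P) (sets P)
     (\<lambda>A. ennreal u * emeasure P A + ennreal (1 - u) * emeasure Q A)"

definition convex_measures :: "'a measure set \<Rightarrow> bool" where
  "convex_measures \<P> \<longleftrightarrow> (\<forall>P\<in>\<P>. \<forall>Q\<in>\<P>. \<forall>u\<in>{0..1}. mixture u P Q \<in> \<P>)"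

definition quasi_surely :: "'a measure set \<Rightarrow> ('a \<Rightarrow> bool) \<Rightarrow> bool" where
  "quasi_surely \<P> \<phi> \<longleftrightarrow> (\<forall>P\<in>\<P>. AE \<omega> in P. \<phi> \<omega>)"

text \<open>\<^term>\<open>absolutely_continuous P Q\<close> is \<open>Q \<lless> P\<close>: its first argument is the dominating
  measure.\<close>

definition dominated_by :: "'a measure \<Rightarrow> 'a measure set \<Rightarrow> bool" where
  "dominated_by Q \<P> \<longleftrightarrow> (\<exists>P\<in>\<P>. absolutely_continuous P Q)"

definition price_increment :: "'b::euclidean_space \<Rightarrow> ('a \<Rightarrow> 'b) \<Rightarrow> 'a \<Rightarrow> 'b" where
  "price_increment S0 S1 \<omega> = S1 \<omega> - S0"

definition no_arbitrage ::
    "'a measure set \<Rightarrow> ('a \<Rightarrow> 'b::euclidean_space) \<Rightarrow> 'b set \<Rightarrow> bool" where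
  "no_arbitrage \<P> \<Delta>S \<H> \<longleftrightarrow>
     (\<forall>H\<in>\<H>. quasi_surely \<P> (\<lambda>\<omega>. H \<bullet> \<Delta>S \<omega> \<ge> 0) \<longrightarrow> quasi_surely \<P> (\<lambda>\<omega>. H \<bullet> \<Delta>S \<omega> = 0))"

text \<open>The order on sets is inclusion, so the least element is the smallest such closed set;
  it exists by \<open>supp_qs_least\<close> below.\<close>

definition supp_qs :: "'a measure set \<Rightarrow> ('a \<Rightarrow> 'b::euclidean_space) \<Rightarrow> 'b set" where
  "supp_qs \<P> \<Delta>S = (LEAST A. closed A \<and> quasi_surely \<P> (\<lambda>\<omega>. \<Delta>S \<omega> \<in> A))"

definition N_perp :: "'a measure set \<Rightarrow> ('a \<Rightarrow> 'b::euclidean_space) \<Rightarrow> 'b set" where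
  "N_perp \<P> \<Delta>S = span (supp_qs \<P> \<Delta>S)"

text \<open>Intended for linear subspaces \<open>V\<close>, where the point exists and is unique
  (\<open>orth_proj_works\<close> below).\<close>

definition orth_proj :: "'b::euclidean_space set \<Rightarrow> 'b \<Rightarrow> 'b" where
  "orth_proj V x = (THE y. y \<in> V \<and> (\<forall>v\<in>V. orthogonal (x - y) v))"

definition proj_strategies ::
    "'a measure set \<Rightarrow> ('a \<Rightarrow> 'b::euclidean_space) \<Rightarrow> 'b set \<Rightarrow> 'b set" where
  "proj_strategies \<P> \<Delta>S \<H> = orth_proj (N_perp \<P> \<Delta>S) ` \<H>"

definition strategy_cone ::
    "'a measure set \<Rightarrow> ('a \<Rightarrow> 'b::euclidean_space) \<Rightarrow> 'b set \<Rightarrow> 'b set" where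
  "strategy_cone \<P> \<Delta>S \<H> = {c *\<^sub>R H | c H. H \<in> proj_strategies \<P> \<Delta>S \<H> \<and> c \<ge> 0}"

definition pricing_measures ::
    "'a::topological_space measure set \<Rightarrow> ('a \<Rightarrow> 'b::euclidean_space) \<Rightarrow> 'b set \<Rightarrow> 'a measure set" where
  "pricing_measures \<P> \<Delta>S \<H> =
     {Q \<in> borel_prob_measures. dominated_by Q \<P> \<and> integrable Q (\<lambda>\<omega>. norm (\<Delta>S \<omega>)) \<and>
        (\<forall>H\<in>\<H>. (\<integral>\<omega>. H \<bullet> \<Delta>S \<omega> \<partial>Q) \<le> 0)}"

lemma emeasure_mixture:
  assumes "sets Q = sets P" "A \<in> sets P"
  shows "emeasure (mixture u P Q) A = ennreal u * emeasure P A + ennreal (1 - u) * emeasure Q A"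
  unfolding mixture_def
proof (rule emeasure_measure_of_sigma)
  show "sigma_algebra (space P) (sets P)" by (rule sets.sigma_algebra_axioms)
  show "positive (sets P) (\<lambda>A. ennreal u * emeasure P A + ennreal (1 - u) * emeasure Q A)"
    by (simp add: positive_def)
  show "countably_additive (sets P) (\<lambda>A. ennreal u * emeasure P A + ennreal (1 - u) * emeasure Q A)"
    unfolding countably_additive_def
  proof (intro allI impI)
    fix B :: "nat \<Rightarrow> _ set"
    assume B: "range B \<subseteq> sets P" "disjoint_family B" "\<Union>(range B) \<in> sets P"
    show "(\<Sum>i. ennreal u * emeasure P (B i) + ennreal (1 - u) * emeasure Q (B i)) =
        ennreal u * emeasure P (\<Union>(range B)) + ennreal (1 - u) * emeasure Q (\<Union>(range B))"
      using B assms(1)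
      by (simp add: suminf_add[symmetric] ennreal_suminf_cmult suminf_emeasure)
  qed
  show "A \<in> sets P" by fact
qed

lemma sets_mixture: "sets (mixture u P Q) = sets P"
  by (simp add: mixture_def sets.space_closed sets.sigma_sets_eq)

lemma mixture_in_borel_prob_measures:
  assumes "P \<in> borel_prob_measures" "Q \<in> borel_prob_measures" "u \<in> {0..1}"
  shows "mixture u P Q \<in> borel_prob_measures"
proof -
  have P: "prob_space P" "sets P = sets borel" and Q: "prob_space Q" "sets Q = sets borel"
    using assms by (auto simp: space_prob_algebra)
  have sp: "space (mixture u P Q) = UNIV" "space P = UNIV" "space Q = UNIV"
    using sets_eq_imp_space_eq[of "mixture u P Q" borel] sets_eq_imp_space_eq[OF P(2)]
      sets_eq_imp_space_eq[OF Q(2)] P(2) by (simp_all add: sets_mixture)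
  have "emeasure (mixture u P Q) UNIV = ennreal u * 1 + ennreal (1 - u) * 1"
    using P Q sp prob_space.emeasure_space_1[OF P(1)] prob_space.emeasure_space_1[OF Q(1)]
    by (subst emeasure_mixture) auto
  also have "\<dots> = 1"
    using assms(3) by (simp flip: ennreal_plus)
  finally show ?thesis
    using P(2) by (auto simp: space_prob_algebra sets_mixture sp intro!: prob_spaceI)
qed

lemma supp_qs_least:
  fixes \<Delta>S :: "'a \<Rightarrow> 'b::euclidean_space"
  shows "closed (supp_qs \<P> \<Delta>S)"
    and "quasi_surely \<P> (\<lambda>\<omega>. \<Delta>S \<omega> \<in> supp_qs \<P> \<Delta>S)"
    and "closed A \<Longrightarrow> quasi_surely \<P> (\<lambda>\<omega>. \<Delta>S \<omega> \<in> A) \<Longrightarrow> supp_qs \<P> \<Delta>S \<subseteq> A"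
proof -
  let ?C = "\<lambda>A. closed A \<and> quasi_surely \<P> (\<lambda>\<omega>. \<Delta>S \<omega> \<in> A)"
  let ?I = "\<Inter>(Collect ?C)"
  obtain F where F: "F \<subseteq> uminus ` Collect ?C" "countable F" "\<Union>F = \<Union>(uminus ` Collect ?C)"
    by (rule Lindelof[of "uminus ` Collect ?C"]) (auto simp: open_Compl)
  have "quasi_surely \<P> (\<lambda>\<omega>. \<Delta>S \<omega> \<in> ?I)"
  proof (rule quasi_surely_def[THEN iffD2, rule_format])
    fix P assume P: "P \<in> \<P>"
    have "AE \<omega> in P. \<forall>U\<in>F. \<Delta>S \<omega> \<notin> U"
    proof (subst AE_ball_countable[OF F(2)], intro ballI)
      fix U assume "U \<in> F"
      then obtain A where "?C A" "U = - A" using F(1) by auto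
      then show "AE \<omega> in P. \<Delta>S \<omega> \<notin> U" using P by (simp add: quasi_surely_def)
    qed
    then show "AE \<omega> in P. \<Delta>S \<omega> \<in> ?I"
    proof (rule eventually_mono)
      fix \<omega> assume "\<forall>U\<in>F. \<Delta>S \<omega> \<notin> U"
      then have "\<Delta>S \<omega> \<notin> \<Union>(uminus ` Collect ?C)" unfolding F(3)[symmetric] by blast
      then show "\<Delta>S \<omega> \<in> ?I" by auto
    qed
  qed
  then have I: "?C ?I" by auto
  have eq: "supp_qs \<P> \<Delta>S = ?I"
    unfolding supp_qs_def using I by (intro Least_equality) auto
  show "closed (supp_qs \<P> \<Delta>S)" "quasi_surely \<P> (\<lambda>\<omega>. \<Delta>S \<omega> \<in> supp_qs \<P> \<Delta>S)"
    using I unfolding eq by blast+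
  show "closed A \<Longrightarrow> quasi_surely \<P> (\<lambda>\<omega>. \<Delta>S \<omega> \<in> A) \<Longrightarrow> supp_qs \<P> \<Delta>S \<subseteq> A"
    unfolding eq by blast
qed

lemma orth_proj_works:
  fixes V :: "'b::euclidean_space set"
  assumes V: "subspace V"
  shows "orth_proj V x \<in> V" and "v \<in> V \<Longrightarrow> orthogonal (x - orth_proj V x) v"
proof -
  obtain y z where y: "y \<in> span V" "\<And>w. w \<in> span V \<Longrightarrow> orthogonal z w" "x = y + z"
    by (rule orthogonal_subspace_decomp_exists[of V x]) blast
  have sp: "span V = V" using V by simp
  have ex: "y \<in> V \<and> (\<forall>v\<in>V. orthogonal (x - y) v)" using y by (simp add: sp)
  have "y' = y" if y': "y' \<in> V \<and> (\<forall>v\<in>V. orthogonal (x - y') v)" for y'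
  proof -
    have "y' - y \<in> V" using y' ex V by (simp add: subspace_diff)
    then have "(x - y) \<bullet> (y' - y) = 0" "(x - y') \<bullet> (y' - y) = 0"
      using y' ex by (auto simp: orthogonal_def)
    then have "(y' - y) \<bullet> (y' - y) = 0" by (simp add: inner_diff_left)
    then show ?thesis by simp
  qed
  then have "orth_proj V x \<in> V \<and> (\<forall>v\<in>V. orthogonal (x - orth_proj V x) v)"
    unfolding orth_proj_def using ex by (rule theI[rotated])
  then show "orth_proj V x \<in> V" "v \<in> V \<Longrightarrow> orthogonal (x - orth_proj V x) v" by auto
qed

end

theory Submission
  imports Defs
begin

text \<open>
  If every \<open>P \<in> \<P>\<close> is dominated by some pricing measure \<open>Q\<close>, then a strategy whose gain is
  nonnegative quasi-surely has a nonnegative gain of nonpositive mean under \<open>Q\<close>; the gain therefore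
  vanishes \<open>Q\<close>-a.s., hence \<open>P\<close>-a.s.

  For the converse, let \<open>C\<close> be the cone of projected strategies. Projecting onto \<open>N_perp\<close> does not
  change gains quasi-surely and removes all redundancy: under no arbitrage an \<open>h \<in> C\<close> with
  nonnegative gain is orthogonal to the support of the price increment and also lies in its span, so
  \<open>h = 0\<close>. Each unit vector of \<open>C\<close> thus loses money with positive probability under some
  member of \<open>\<P>\<close>. Losing money is an open condition on the strategy
  (\<open>closed_AE_nonneg_gain\<close>), the unit sphere of \<open>C\<close> is compact, and finitely many members of the
  convex set \<open>\<P>\<close> are dominated by one member. Hence a single \<open>P' \<in> \<P>\<close> dominates the given
  \<open>P\<close> and detects the losses of every nonzero \<open>h \<in> C\<close>
  (\<open>single_measure_detecting_losses\<close>).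

  It remains to treat the one measure \<open>P'\<close>. There the pricing measure is an Esscher transform: the
  exponential disutility \<open>h \<mapsto> E[exp (- |X|\<^sup>2 - h \<bullet> X)]\<close> is convex, finite because of the
  Gaussian damping, and coercive on \<open>C\<close> because nonzero strategies can lose. At a minimiser over the
  convex cone \<open>C\<close> the directional derivatives along \<open>C\<close> are nonnegative, which says precisely
  that the tilted probability measure gives every gain a nonpositive mean
  (\<open>exponential_minimiser\<close>). The tilting density is positive, so the new measure is equivalent to
  \<open>P'\<close> and still dominates \<open>P\<close>.
\<close>

section \<open>Damped exponential disutility\<close>

text \<open>The Gaussian factor beats the exponential tilt together with a factor of linear growth, so
  the tilt, the increment and all gains become integrable under any probability measure.\<close>

lemma damped_exp_bound:
  fixes h x :: "'b::euclidean_space"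
  shows "(1 + norm x) * exp (- (norm x)\<^sup>2 - h \<bullet> x) \<le> exp ((norm h + 1)\<^sup>2)"
proof -
  let ?y = "norm x" and ?c = "norm h + 1"
  have "- (h \<bullet> x) \<le> norm h * ?y"
    using norm_cauchy_schwarz[of "- h" x] by simp
  then have "?y - ?y\<^sup>2 - h \<bullet> x \<le> ?c * ?y - ?y\<^sup>2"
    by (simp add: algebra_simps)
  also have "\<dots> \<le> ?c\<^sup>2"
  proof -
    have "0 \<le> (?c - ?y / 2)\<^sup>2 + 3 / 4 * ?y\<^sup>2" by simp
    then show ?thesis by (simp add: power2_eq_square algebra_simps)
  qed
  finally have le: "?y - ?y\<^sup>2 - h \<bullet> x \<le> ?c\<^sup>2" .
  have "(1 + ?y) * exp (- ?y\<^sup>2 - h \<bullet> x) \<le> exp ?y * exp (- ?y\<^sup>2 - h \<bullet> x)"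
    by (intro mult_right_mono exp_ge_add_one_self) simp
  also have "\<dots> = exp (?y - ?y\<^sup>2 - h \<bullet> x)"
    by (simp flip: exp_add add: algebra_simps)
  finally show ?thesis using le by (meson exp_le_cancel_iff order_trans)
qed

lemma (in prob_space) integrable_damped_exp:
  fixes X :: "'a \<Rightarrow> 'b::euclidean_space" and f :: "'a \<Rightarrow> real"
  assumes X: "X \<in> borel_measurable M" and f: "f \<in> borel_measurable M"
    and bound: "\<And>\<omega>. \<bar>f \<omega>\<bar> \<le> c * (1 + norm (X \<omega>))"
  shows "integrable M (\<lambda>\<omega>. exp (- (norm (X \<omega>))\<^sup>2 - h \<bullet> X \<omega>) * f \<omega>)"
proof (rule integrable_const_bound[where B = "c * exp ((norm h + 1)\<^sup>2)"])
  have c: "0 \<le> c"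
  proof -
    have "0 \<le> c * (1 + norm (X undefined))" using bound[of undefined] by linarith
    moreover have "0 < 1 + norm (X undefined)" by (simp add: add_pos_nonneg)
    ultimately show ?thesis by (simp add: zero_le_mult_iff)
  qed
  show "AE \<omega> in M. norm (exp (- (norm (X \<omega>))\<^sup>2 - h \<bullet> X \<omega>) * f \<omega>) \<le> c * exp ((norm h + 1)\<^sup>2)"
  proof (rule AE_I2)
    fix \<omega>
    have "norm (exp (- (norm (X \<omega>))\<^sup>2 - h \<bullet> X \<omega>) * f \<omega>)
        \<le> exp (- (norm (X \<omega>))\<^sup>2 - h \<bullet> X \<omega>) * (c * (1 + norm (X \<omega>)))"
      using bound[of \<omega>] by (simp add: abs_mult mult_left_mono)
    also have "\<dots> = c * ((1 + norm (X \<omega>)) * exp (- (norm (X \<omega>))\<^sup>2 - h \<bullet> X \<omega>))"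
      by (simp add: algebra_simps)
    also have "\<dots> \<le> c * exp ((norm h + 1)\<^sup>2)"
      by (intro mult_left_mono damped_exp_bound c)
    finally show "norm (exp (- (norm (X \<omega>))\<^sup>2 - h \<bullet> X \<omega>) * f \<omega>) \<le> c * exp ((norm h + 1)\<^sup>2)" .
  qed
  show "(\<lambda>\<omega>. exp (- (norm (X \<omega>))\<^sup>2 - h \<bullet> X \<omega>) * f \<omega>) \<in> borel_measurable M"
    using X f by measurable
qed

text \<open>The expected loss supplies coercivity: \<open>exp (- h \<bullet> x)\<close> is at least the loss
  \<open>max 0 (- h \<bullet> x)\<close>, whose damped mean is positively homogeneous in \<open>h\<close> and, by compactness of
  the unit sphere, bounded below by a multiple of \<open>norm h\<close> as soon as every nonzero \<open>h\<close> can
  lose.\<close>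

lemma (in prob_space) expected_loss_lower_bound:
  fixes X :: "'a \<Rightarrow> 'b::euclidean_space"
  assumes X: "X \<in> borel_measurable M"
    and K: "closed K" "\<And>h c. h \<in> K \<Longrightarrow> 0 \<le> c \<Longrightarrow> c *\<^sub>R h \<in> K"
    and lose: "\<And>h. h \<in> K \<Longrightarrow> AE \<omega> in M. 0 \<le> h \<bullet> X \<omega> \<Longrightarrow> h = 0"
  obtains m where "0 < m"
    and "\<And>h. h \<in> K \<Longrightarrow> m * norm h \<le> (\<integral>\<omega>. exp (- (norm (X \<omega>))\<^sup>2) * max 0 (- (h \<bullet> X \<omega>)) \<partial>M)"
proof -
  define g where "g h = (\<integral>\<omega>. exp (- (norm (X \<omega>))\<^sup>2) * max 0 (- (h \<bullet> X \<omega>)) \<partial>M)" for h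
  have int: "integrable M (\<lambda>\<omega>. exp (- (norm (X \<omega>))\<^sup>2) * max 0 (- (h \<bullet> X \<omega>)))" for h
  proof -
    have "\<bar>max 0 (- (h \<bullet> X \<omega>))\<bar> \<le> norm h * (1 + norm (X \<omega>))" for \<omega>
      using Cauchy_Schwarz_ineq2[of h "X \<omega>"] norm_ge_zero[of h] unfolding distrib_left by linarith
    then show ?thesis
      using integrable_damped_exp[OF X, of "\<lambda>\<omega>. max 0 (- (h \<bullet> X \<omega>))" "norm h" 0] X by simp
  qed
  have "convex_on UNIV g"
  proof (rule convex_onI)
    fix t :: real and h k :: 'b
    assume t: "0 < t" "t < 1"
    have "max 0 (- (((1 - t) *\<^sub>R h + t *\<^sub>R k) \<bullet> x)) \<le> (1 - t) * max 0 (- (h \<bullet> x)) + t * max 0 (- (k \<bullet> x))"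
      for x
    proof -
      have "(1 - t) * - (h \<bullet> x) \<le> (1 - t) * max 0 (- (h \<bullet> x))" "t * - (k \<bullet> x) \<le> t * max 0 (- (k \<bullet> x))"
        using t by (intro mult_left_mono; simp)+
      moreover have "0 \<le> (1 - t) * max 0 (- (h \<bullet> x)) + t * max 0 (- (k \<bullet> x))" using t by simp
      ultimately show ?thesis by (simp add: inner_add_left)
    qed
    then have "g ((1 - t) *\<^sub>R h + t *\<^sub>R k)
        \<le> (\<integral>\<omega>. (1 - t) * (exp (- (norm (X \<omega>))\<^sup>2) * max 0 (- (h \<bullet> X \<omega>)))
            + t * (exp (- (norm (X \<omega>))\<^sup>2) * max 0 (- (k \<bullet> X \<omega>))) \<partial>M)"
      unfolding g_def
    proof (intro Bochner_Integration.integral_mono int Bochner_Integration.integrable_add integrable_mult_right, goal_cases)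
      case (1 \<omega>)
      then show ?case using mult_left_mono[OF 1(1)[of "X \<omega>"], of "exp (- (norm (X \<omega>))\<^sup>2)"]
        by (simp add: algebra_simps)
    qed
    then show "g ((1 - t) *\<^sub>R h + t *\<^sub>R k) \<le> (1 - t) * g h + t * g k"
      using int by (simp add: g_def)
  qed simp
  then have cont: "continuous_on UNIV g" by (rule convex_on_continuous[OF open_UNIV])
  have pos: "0 < g h" if "h \<in> K" "h \<noteq> 0" for h
  proof (rule ccontr)
    assume "\<not> 0 < g h"
    moreover have "0 \<le> g h" unfolding g_def by (intro Bochner_Integration.integral_nonneg) simp
    ultimately have "g h = 0" by simp
    then have "AE \<omega> in M. exp (- (norm (X \<omega>))\<^sup>2) * max 0 (- (h \<bullet> X \<omega>)) = 0"
      unfolding g_def by (subst (asm) integral_nonneg_eq_0_iff_AE[OF int]) auto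
    then have "AE \<omega> in M. 0 \<le> h \<bullet> X \<omega>" by eventually_elim (simp add: max_def split: if_splits)
    then show False using lose that by blast
  qed
  have hom: "g (c *\<^sub>R h) = c * g h" if "0 \<le> c" for c h
  proof -
    have "max 0 (- (c * y)) = c * max 0 (- y)" for y
      using that by (simp add: max_mult_distrib_left)
    then have "exp (- (norm x)\<^sup>2) * max 0 (- ((c *\<^sub>R h) \<bullet> x))
        = c * (exp (- (norm x)\<^sup>2) * max 0 (- (h \<bullet> x)))" for x :: 'b
      by (metis inner_scaleR_left mult.left_commute)
    then show ?thesis unfolding g_def by (simp only: integral_mult_right_zero)
  qed
  have cpt: "compact (K \<inter> sphere 0 1)" by (intro closed_Int_compact K compact_sphere)
  have norm1: "h /\<^sub>R norm h \<in> K \<inter> sphere 0 1" if "h \<in> K" "h \<noteq> 0" for h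
    using that by (auto intro!: K(2))
  show thesis
  proof (cases "K \<inter> sphere 0 1 = {}")
    case True
    then have zero: "h = 0" if "h \<in> K" for h using norm1 that by blast
    show thesis by (rule that[of 1]) (auto dest!: zero)
  next
    case False
    then obtain u where u: "u \<in> K \<inter> sphere 0 1" "\<And>v. v \<in> K \<inter> sphere 0 1 \<Longrightarrow> g u \<le> g v"
      using continuous_attains_inf[OF cpt] cont by (meson continuous_on_subset subset_UNIV)
    have "g u * norm h \<le> g h" if "h \<in> K" for h
    proof (cases "h = 0")
      case False
      then have "g u \<le> g h / norm h" using u(2)[OF norm1[OF that]] by (simp add: hom divide_inverse mult.commute)
      then show ?thesis using False by (simp add: field_simps)
    qed (simp add: g_def)
    moreover have "0 < g u" using u(1) by (intro pos) auto
    ultimately show thesis using that[of "g u"] by (simp add: g_def)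
  qed
qed

text \<open>The objective is convex, hence continuous, so it attains its minimum on the compact part of
  the cone outside which coercivity makes it exceed its value at \<open>0\<close>. The conclusion is the first
  order condition at the minimiser \<open>z\<close>: for \<open>h \<in> K\<close> the points \<open>z + t h\<close> with \<open>t > 0\<close> remain in
  the convex cone, so the objective cannot decrease in this direction.\<close>

lemma (in prob_space) exponential_minimiser:
  fixes X :: "'a \<Rightarrow> 'b::euclidean_space"
  assumes X: "X \<in> borel_measurable M"
    and K: "closed K" "0 \<in> K" "\<And>h c. h \<in> K \<Longrightarrow> 0 \<le> c \<Longrightarrow> c *\<^sub>R h \<in> K"
      "\<And>h k. h \<in> K \<Longrightarrow> k \<in> K \<Longrightarrow> h + k \<in> K"
    and lose: "\<And>h. h \<in> K \<Longrightarrow> AE \<omega> in M. 0 \<le> h \<bullet> X \<omega> \<Longrightarrow> h = 0"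
  obtains z where "z \<in> K"
    and "\<And>h. h \<in> K \<Longrightarrow> (\<integral>\<omega>. exp (- (norm (X \<omega>))\<^sup>2 - z \<bullet> X \<omega>) * (h \<bullet> X \<omega>) \<partial>M) \<le> 0"
proof -
  obtain m where m: "0 < m"
    "\<And>h. h \<in> K \<Longrightarrow> m * norm h \<le> (\<integral>\<omega>. exp (- (norm (X \<omega>))\<^sup>2) * max 0 (- (h \<bullet> X \<omega>)) \<partial>M)"
    using expected_loss_lower_bound[OF X K(1,3) lose] by blast
  define w where "w h \<omega> = exp (- (norm (X \<omega>))\<^sup>2 - h \<bullet> X \<omega>)" for h \<omega>
  define f where "f h = (\<integral>\<omega>. w h \<omega> \<partial>M)" for h
  have gain_bound: "\<bar>h \<bullet> X \<omega>\<bar> \<le> norm h * (1 + norm (X \<omega>))" for h \<omega>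
    using Cauchy_Schwarz_ineq2[of h "X \<omega>"] norm_ge_zero[of h] unfolding distrib_left by linarith
  have int: "integrable M (w h)" for h
    using integrable_damped_exp[OF X, of "\<lambda>_. 1" 1 h] by (simp add: w_def[abs_def])
  have int_gain: "integrable M (\<lambda>\<omega>. w z \<omega> * (h \<bullet> X \<omega>))" for z h
    unfolding w_def by (intro integrable_damped_exp[OF X, where c = "norm h"] gain_bound)
      (use X in measurable)
  have "convex_on UNIV f"
  proof (rule convex_onI)
    fix t :: real and h k :: 'b
    assume t: "0 < t" "t < 1"
    have "w ((1 - t) *\<^sub>R h + t *\<^sub>R k) \<omega> \<le> (1 - t) * w h \<omega> + t * w k \<omega>" for \<omega>
    proof -
      have "- (norm (X \<omega>))\<^sup>2 - ((1 - t) *\<^sub>R h + t *\<^sub>R k) \<bullet> X \<omega>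
          = (1 - t) *\<^sub>R (- (norm (X \<omega>))\<^sup>2 - h \<bullet> X \<omega>) + t *\<^sub>R (- (norm (X \<omega>))\<^sup>2 - k \<bullet> X \<omega>)"
        by (simp add: inner_add_left algebra_simps)
      then show ?thesis
        unfolding w_def using convex_onD[OF exp_convex, of t] t by simp
    qed
    then have "f ((1 - t) *\<^sub>R h + t *\<^sub>R k) \<le> (\<integral>\<omega>. (1 - t) * w h \<omega> + t * w k \<omega> \<partial>M)"
      unfolding f_def using int by (intro Bochner_Integration.integral_mono) auto
    then show "f ((1 - t) *\<^sub>R h + t *\<^sub>R k) \<le> (1 - t) * f h + t * f k"
      using int by (simp add: f_def)
  qed simp
  then have cont: "continuous_on UNIV f" by (rule convex_on_continuous[OF open_UNIV])
  have coercive: "m * norm h \<le> f h" if "h \<in> K" for h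
  proof -
    have "exp (- (norm (X \<omega>))\<^sup>2) * max 0 (- (h \<bullet> X \<omega>)) \<le> w h \<omega>" for \<omega>
    proof -
      have "max 0 (- (h \<bullet> X \<omega>)) \<le> exp (- (h \<bullet> X \<omega>))"
        using exp_ge_add_one_self[of "- (h \<bullet> X \<omega>)"] by simp
      then have "exp (- (norm (X \<omega>))\<^sup>2) * max 0 (- (h \<bullet> X \<omega>))
          \<le> exp (- (norm (X \<omega>))\<^sup>2) * exp (- (h \<bullet> X \<omega>))"
        by (rule mult_left_mono) simp
      then show ?thesis by (simp add: w_def flip: exp_add)
    qed
    then have "(\<integral>\<omega>. exp (- (norm (X \<omega>))\<^sup>2) * max 0 (- (h \<bullet> X \<omega>)) \<partial>M) \<le> f h"
      unfolding f_def by (intro integral_mono_AE' int) (auto simp: w_def)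
    then show ?thesis using m(2)[OF that] by linarith
  qed
  have f0: "0 \<le> f 0" unfolding f_def w_def by simp
  have "compact (K \<inter> cball 0 (f 0 / m))" by (intro closed_Int_compact K compact_cball)
  moreover have in0: "0 \<in> K \<inter> cball 0 (f 0 / m)" using K(2) f0 m(1) by simp
  ultimately obtain z where z: "z \<in> K \<inter> cball 0 (f 0 / m)"
    and z_min: "\<And>h. h \<in> K \<inter> cball 0 (f 0 / m) \<Longrightarrow> f z \<le> f h"
    using continuous_attains_inf[of "K \<inter> cball 0 (f 0 / m)" f] cont
    by (metis continuous_on_subset empty_iff subset_UNIV)
  have min: "f z \<le> f h" if "h \<in> K" for h
  proof (cases "norm h \<le> f 0 / m")
    case False
    then have "f 0 \<le> f h" using coercive[OF that] m(1) by (simp add: field_simps)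
    then show ?thesis using z_min[OF in0] by linarith
  qed (use z_min that in auto)
  show thesis
  proof (rule that[of z])
    show "z \<in> K" using z by simp
    fix h assume h: "h \<in> K"
    define s where "s n = 1 / real (Suc n)" for n
    have s: "0 < s n" "s n \<le> 1" for n by (auto simp: s_def)
    have le: "(\<integral>\<omega>. w (z + s n *\<^sub>R h) \<omega> * (h \<bullet> X \<omega>) \<partial>M) \<le> 0" for n
    proof -
      \<comment> \<open>Convexity of \<open>exp\<close>, with the tangent taken at the shifted point \<open>z + s n h\<close>, turns
        minimality into a bound on the derivative there.\<close>
      have "s n * (w (z + s n *\<^sub>R h) \<omega> * (h \<bullet> X \<omega>)) \<le> w z \<omega> - w (z + s n *\<^sub>R h) \<omega>" for \<omega>
      proof -
        have "w z \<omega> = w (z + s n *\<^sub>R h) \<omega> * exp (s n * (h \<bullet> X \<omega>))"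
          by (simp add: w_def inner_add_left flip: exp_add)
        moreover have "w (z + s n *\<^sub>R h) \<omega> * (1 + s n * (h \<bullet> X \<omega>))
            \<le> w (z + s n *\<^sub>R h) \<omega> * exp (s n * (h \<bullet> X \<omega>))"
          by (intro mult_left_mono exp_ge_add_one_self) (simp add: w_def)
        ultimately show ?thesis by (simp add: algebra_simps)
      qed
      then have "(\<integral>\<omega>. s n * (w (z + s n *\<^sub>R h) \<omega> * (h \<bullet> X \<omega>)) \<partial>M)
          \<le> (\<integral>\<omega>. w z \<omega> - w (z + s n *\<^sub>R h) \<omega> \<partial>M)"
        by (intro Bochner_Integration.integral_mono integrable_mult_right int_gain Bochner_Integration.integrable_diff int)
      also have "\<dots> = f z - f (z + s n *\<^sub>R h)"
        unfolding f_def by (intro Bochner_Integration.integral_diff int)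
      also have "\<dots> \<le> 0"
        using min[of "z + s n *\<^sub>R h"] z h s[of n] K(3,4) by (simp add: less_imp_le)
      finally show ?thesis using s[of n] by (simp add: mult_le_0_iff)
    qed
    have "(\<lambda>n. \<integral>\<omega>. w (z + s n *\<^sub>R h) \<omega> * (h \<bullet> X \<omega>) \<partial>M) \<longlonglongrightarrow> (\<integral>\<omega>. w z \<omega> * (h \<bullet> X \<omega>) \<partial>M)"
    \<comment> \<open>For \<open>0 \<le> s \<le> 1\<close> the tilt by \<open>z + s h\<close> is at most the sum of the tilts by \<open>z\<close> and
      \<open>z + h\<close>.\<close>
    proof (rule integral_dominated_convergence
        [where w = "\<lambda>\<omega>. \<bar>w z \<omega> * (h \<bullet> X \<omega>)\<bar> + \<bar>w (z + h) \<omega> * (h \<bullet> X \<omega>)\<bar>"])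
      have meas: "(\<lambda>\<omega>. w z \<omega> * (h \<bullet> X \<omega>)) \<in> borel_measurable M" for z
        by (rule borel_measurable_integrable[OF int_gain])
      show "(\<lambda>\<omega>. w z \<omega> * (h \<bullet> X \<omega>)) \<in> borel_measurable M"
        "(\<lambda>\<omega>. w (z + s n *\<^sub>R h) \<omega> * (h \<bullet> X \<omega>)) \<in> borel_measurable M" for n
        by (rule meas)+
      show "integrable M (\<lambda>\<omega>. \<bar>w z \<omega> * (h \<bullet> X \<omega>)\<bar> + \<bar>w (z + h) \<omega> * (h \<bullet> X \<omega>)\<bar>)"
        by (intro Bochner_Integration.integrable_add integrable_abs int_gain)
      have "s \<longlonglongrightarrow> 0"
        unfolding s_def by (rule LIMSEQ_Suc[OF lim_1_over_n])
      then have "(\<lambda>n. exp (- (norm (X \<omega>))\<^sup>2 - (z + s n *\<^sub>R h) \<bullet> X \<omega>) * (h \<bullet> X \<omega>))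
          \<longlonglongrightarrow> exp (- (norm (X \<omega>))\<^sup>2 - (z + 0 *\<^sub>R h) \<bullet> X \<omega>) * (h \<bullet> X \<omega>)" for \<omega>
        by (intro tendsto_intros)
      then show "AE \<omega> in M. (\<lambda>n. w (z + s n *\<^sub>R h) \<omega> * (h \<bullet> X \<omega>)) \<longlonglongrightarrow> w z \<omega> * (h \<bullet> X \<omega>)"
        by (simp add: w_def)
      show "AE \<omega> in M. norm (w (z + s n *\<^sub>R h) \<omega> * (h \<bullet> X \<omega>))
          \<le> \<bar>w z \<omega> * (h \<bullet> X \<omega>)\<bar> + \<bar>w (z + h) \<omega> * (h \<bullet> X \<omega>)\<bar>" for n
      proof (rule AE_I2)
        fix \<omega>
        have "w (z + s n *\<^sub>R h) \<omega> \<le> w z \<omega> + w (z + h) \<omega>"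
        proof (cases "0 \<le> h \<bullet> X \<omega>")
          case True
          then have "w (z + s n *\<^sub>R h) \<omega> \<le> w z \<omega>"
            using s(1)[of n] by (simp add: w_def inner_add_left)
          moreover have "0 \<le> w (z + h) \<omega>" by (simp add: w_def)
          ultimately show ?thesis by linarith
        next
          case False
          then have "h \<bullet> X \<omega> \<le> s n * (h \<bullet> X \<omega>)"
            using mult_right_mono_neg[of "s n" 1 "h \<bullet> X \<omega>"] s(2)[of n] by simp
          then have "w (z + s n *\<^sub>R h) \<omega> \<le> w (z + h) \<omega>"
            by (simp add: w_def inner_add_left)
          moreover have "0 \<le> w z \<omega>" by (simp add: w_def)
          ultimately show ?thesis by linarith
        qed
        from mult_right_mono[OF this, of "\<bar>h \<bullet> X \<omega>\<bar>"]
        show "norm (w (z + s n *\<^sub>R h) \<omega> * (h \<bullet> X \<omega>))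
          \<le> \<bar>w z \<omega> * (h \<bullet> X \<omega>)\<bar> + \<bar>w (z + h) \<omega> * (h \<bullet> X \<omega>)\<bar>"
          by (simp add: abs_mult w_def algebra_simps)
      qed
    qed
    then show "(\<integral>\<omega>. exp (- (norm (X \<omega>))\<^sup>2 - z \<bullet> X \<omega>) * (h \<bullet> X \<omega>) \<partial>M) \<le> 0"
      using le unfolding w_def by (intro LIMSEQ_le_const2) auto
  qed
qed

text \<open>Normalising the tilt of \<open>exponential_minimiser\<close> gives the pricing measure. Its density is
  strictly positive, whence the equivalence of the two measures.\<close>

lemma (in prob_space) equivalent_pricing_measure:
  fixes X :: "'a \<Rightarrow> 'b::euclidean_space"
  assumes X: "X \<in> borel_measurable M"
    and K: "closed K" "0 \<in> K" "\<And>h c. h \<in> K \<Longrightarrow> 0 \<le> c \<Longrightarrow> c *\<^sub>R h \<in> K"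
      "\<And>h k. h \<in> K \<Longrightarrow> k \<in> K \<Longrightarrow> h + k \<in> K"
    and lose: "\<And>h. h \<in> K \<Longrightarrow> AE \<omega> in M. 0 \<le> h \<bullet> X \<omega> \<Longrightarrow> h = 0"
  obtains Q where "prob_space Q" "sets Q = sets M"
    and "absolutely_continuous M Q" "absolutely_continuous Q M"
    and "integrable Q (\<lambda>\<omega>. norm (X \<omega>))"
    and "\<And>h. h \<in> K \<Longrightarrow> (\<integral>\<omega>. h \<bullet> X \<omega> \<partial>Q) \<le> 0"
proof -
  obtain z where z: "z \<in> K"
    "\<And>h. h \<in> K \<Longrightarrow> (\<integral>\<omega>. exp (- (norm (X \<omega>))\<^sup>2 - z \<bullet> X \<omega>) * (h \<bullet> X \<omega>) \<partial>M) \<le> 0"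
    using exponential_minimiser[OF X K lose] by blast
  define w where "w \<omega> = exp (- (norm (X \<omega>))\<^sup>2 - z \<bullet> X \<omega>)" for \<omega>
  define c where "c = (\<integral>\<omega>. w \<omega> \<partial>M)"
  have w_pos: "0 < w \<omega>" for \<omega> by (simp add: w_def)
  have w_meas [measurable]: "w \<in> borel_measurable M" using X unfolding w_def by measurable
  have int: "integrable M w"
    using integrable_damped_exp[OF X, of "\<lambda>_. 1" 1 z] by (simp add: w_def[abs_def])
  have "c \<noteq> 0"
  proof
    assume "c = 0"
    then have "AE \<omega> in M. w \<omega> = 0"
      unfolding c_def by (subst (asm) integral_nonneg_eq_0_iff_AE[OF int]) (auto simp: less_imp_le w_pos)
    then have "AE \<omega> in M. False" by eventually_elim (use w_pos in \<open>simp add: less_le\<close>)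
    then show False by simp
  qed
  moreover have "0 \<le> c" unfolding c_def by (intro Bochner_Integration.integral_nonneg) (simp add: less_imp_le w_pos)
  ultimately have c: "0 < c" by simp
  define Q where "Q = density M (\<lambda>\<omega>. ennreal (w \<omega> / c))"
  have dens_pos: "0 < w \<omega> / c" for \<omega> using c w_pos by simp
  have int_Q: "integral\<^sup>L Q (\<lambda>\<omega>. g \<omega> :: real) = (\<integral>\<omega>. w \<omega> * g \<omega> \<partial>M) / c"
    if "g \<in> borel_measurable M" for g
    unfolding Q_def using that dens_pos
    by (subst integral_density) (auto simp: less_imp_le)
  have abs_Q: "AE \<omega> in M. R \<omega>" if "AE \<omega> in Q. R \<omega>" for R
    using that dens_pos unfolding Q_def by (subst (asm) AE_density) auto
  have sets_Q: "sets Q = sets M" by (simp add: Q_def)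
  show thesis
  proof (rule that[of Q])
    have "emeasure Q (space Q) = (\<integral>\<^sup>+\<omega>. ennreal (w \<omega> / c) \<partial>M)"
      unfolding Q_def by (subst emeasure_density) (auto cong: nn_integral_cong)
    also have "\<dots> = ennreal (\<integral>\<omega>. w \<omega> / c \<partial>M)"
      using int dens_pos by (intro nn_integral_eq_integral) (auto simp: less_imp_le)
    also have "\<dots> = 1" using c by (simp flip: c_def)
    finally show "prob_space Q" by (rule prob_spaceI)
    show "sets Q = sets M" by (rule sets_Q)
    show "absolutely_continuous M Q" unfolding Q_def
      by (intro absolutely_continuousI_density) measurable
    show "absolutely_continuous Q M"
    proof (unfold absolutely_continuous_def, rule subsetI)
      fix A assume A: "A \<in> null_sets Q"
      then have "AE \<omega> in Q. \<omega> \<notin> A" by (rule AE_not_in)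
      then show "A \<in> null_sets M"
        using abs_Q A by (subst AE_iff_null_sets) (auto simp: sets_Q dest: null_setsD2)
    qed
    have "integrable M (\<lambda>\<omega>. w \<omega> * norm (X \<omega>))"
      unfolding w_def by (rule integrable_damped_exp[OF X, where c = 1]) (use X in auto)
    then have "integrable M (\<lambda>\<omega>. (w \<omega> / c) *\<^sub>R norm (X \<omega>))"
      using integrable_divide[of M "\<lambda>\<omega>. w \<omega> * norm (X \<omega>)" c] by simp
    then show "integrable Q (\<lambda>\<omega>. norm (X \<omega>))"
      unfolding Q_def using X dens_pos by (subst integrable_density) (auto simp: less_imp_le)
    show "(\<integral>\<omega>. h \<bullet> X \<omega> \<partial>Q) \<le> 0" if "h \<in> K" for h
    proof -
      have "(\<lambda>\<omega>. h \<bullet> X \<omega>) \<in> borel_measurable M" using X by measurable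
      then show ?thesis using int_Q z(2)[OF that] c by (simp add: w_def divide_le_0_iff)
    qed
  qed
qed

section \<open>Reduction to one measure\<close>

lemma absolutely_continuous_mixture:
  assumes "sets Q = sets P" and u: "0 < u" "u < 1"
  shows "absolutely_continuous (mixture u P Q) P" "absolutely_continuous (mixture u P Q) Q"
proof -
  have "A \<in> null_sets P \<and> A \<in> null_sets Q" if "A \<in> null_sets (mixture u P Q)" for A
  proof -
    have A: "A \<in> sets P" using null_setsD2[OF that] by (simp add: sets_mixture)
    then have "ennreal u * emeasure P A + ennreal (1 - u) * emeasure Q A = 0"
      using null_setsD1[OF that] emeasure_mixture[OF assms(1) A] by simp
    then show ?thesis using u A assms(1) by (auto simp: ennreal_eq_0_iff)
  qed
  then show "absolutely_continuous (mixture u P Q) P" "absolutely_continuous (mixture u P Q) Q"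
    by (auto simp: absolutely_continuous_def)
qed

lemma absolutely_continuous_trans:
  "absolutely_continuous P Q \<Longrightarrow> absolutely_continuous Q R \<Longrightarrow> absolutely_continuous P R"
  by (auto simp: absolutely_continuous_def)

lemma finite_subset_dominated:
  assumes conv: "convex_measures \<P>" and sets: "\<And>P. P \<in> \<P> \<Longrightarrow> sets P = sets N"
    and F: "finite F" "F \<subseteq> \<P>" and P: "P \<in> \<P>"
  obtains R where "R \<in> \<P>" "absolutely_continuous R P" "\<And>Q. Q \<in> F \<Longrightarrow> absolutely_continuous R Q"
proof -
  from F have "\<exists>R\<in>\<P>. \<forall>Q\<in>insert P F. absolutely_continuous R Q"
  proof (induction F)
    case empty
    show ?case using P by (auto simp: absolutely_continuous_def)
  next
    case (insert Q F)
    then obtain R where R: "R \<in> \<P>" "\<forall>Q\<in>insert P F. absolutely_continuous R Q" by auto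
    have ac: "absolutely_continuous (mixture (1/2) R Q) R" "absolutely_continuous (mixture (1/2) R Q) Q"
      using absolutely_continuous_mixture[of Q R "1/2"] sets R(1) insert.prems by auto
    have "mixture (1/2) R Q \<in> \<P>" using conv R(1) insert.prems by (simp add: convex_measures_def)
    then show ?case using ac R(2) absolutely_continuous_trans by blast
  qed
  then show thesis using that by blast
qed

text \<open>Along a convergent sequence of strategies only countably many null sets are involved.\<close>

lemma closed_AE_nonneg_gain:
  fixes X :: "'a \<Rightarrow> 'b::euclidean_space"
  shows "closed {h. AE \<omega> in P. 0 \<le> h \<bullet> X \<omega>}"
proof (unfold closed_sequential_limits, intro allI impI, elim conjE)
  fix k :: "nat \<Rightarrow> 'b" and h
  assume "\<forall>n. k n \<in> {h. AE \<omega> in P. 0 \<le> h \<bullet> X \<omega>}" and lim: "k \<longlonglongrightarrow> h"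
  then have "AE \<omega> in P. \<forall>n. 0 \<le> k n \<bullet> X \<omega>" by (simp add: AE_all_countable)
  then have "AE \<omega> in P. 0 \<le> h \<bullet> X \<omega>"
  proof eventually_elim
    case (elim \<omega>)
    then show ?case using tendsto_inner[OF lim tendsto_const[of "X \<omega>"]]
      by (intro LIMSEQ_le_const) auto
  qed
  then show "h \<in> {h. AE \<omega> in P. 0 \<le> h \<bullet> X \<omega>}" by simp
qed

text \<open>A priori the measure under which \<open>h\<close> loses depends on \<open>h\<close>. The strategies that lose under
  a fixed measure form an open set, so finitely many measures suffice for the unit sphere of the
  cone, and convexity merges them into one.\<close>

lemma single_measure_detecting_losses:
  fixes X :: "'a \<Rightarrow> 'b::euclidean_space"
  assumes conv: "convex_measures \<P>" and sets: "\<And>P. P \<in> \<P> \<Longrightarrow> sets P = sets N"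
    and K: "closed K" "\<And>h c. h \<in> K \<Longrightarrow> 0 \<le> c \<Longrightarrow> c *\<^sub>R h \<in> K"
    and lose: "\<And>h. h \<in> K \<Longrightarrow> quasi_surely \<P> (\<lambda>\<omega>. 0 \<le> h \<bullet> X \<omega>) \<Longrightarrow> h = 0"
    and P: "P \<in> \<P>"
  obtains R where "R \<in> \<P>" "absolutely_continuous R P"
    and "\<And>h. h \<in> K \<Longrightarrow> AE \<omega> in R. 0 \<le> h \<bullet> X \<omega> \<Longrightarrow> h = 0"
proof -
  define U where "U Q = - {h. AE \<omega> in Q. 0 \<le> h \<bullet> X \<omega>}" for Q
  have "compact (K \<inter> sphere 0 1)" by (intro closed_Int_compact K compact_sphere)
  moreover have "open (U Q)" if "Q \<in> \<P>" for Q
    unfolding U_def by (intro open_Compl closed_AE_nonneg_gain)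
  moreover have "K \<inter> sphere 0 1 \<subseteq> (\<Union>Q\<in>\<P>. U Q)"
    using lose by (force simp: U_def quasi_surely_def)
  ultimately obtain F where F: "F \<subseteq> \<P>" "finite F" "K \<inter> sphere 0 1 \<subseteq> (\<Union>Q\<in>F. U Q)"
    by (rule compactE_image)
  obtain R where R: "R \<in> \<P>" "absolutely_continuous R P" "\<And>Q. Q \<in> F \<Longrightarrow> absolutely_continuous R Q"
    using finite_subset_dominated[OF conv sets F(2,1) P] by blast
  have "h = 0" if h: "h \<in> K" "AE \<omega> in R. 0 \<le> h \<bullet> X \<omega>" for h
  proof (rule ccontr)
    assume "h \<noteq> 0"
    then have "h /\<^sub>R norm h \<in> K \<inter> sphere 0 1" using h K by auto
    then obtain Q where Q: "Q \<in> F" "h /\<^sub>R norm h \<in> U Q" using F(3) by blast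
    have "AE \<omega> in Q. 0 \<le> h \<bullet> X \<omega>"
      using absolutely_continuous_AE[OF _ R(3)[OF Q(1)] h(2)] sets[of Q] sets[OF R(1)] Q(1) F(1) by auto
    then have "AE \<omega> in Q. 0 \<le> (h /\<^sub>R norm h) \<bullet> X \<omega>" by eventually_elim simp
    then show False using Q(2) by (simp add: U_def)
  qed
  then show thesis using that R by blast
qed

section \<open>Projected strategies\<close>

text \<open>The increment lies in \<open>N_perp\<close> quasi-surely, and projecting changes \<open>H\<close> only by a vector
  orthogonal to \<open>N_perp\<close>.\<close>

lemma orth_proj_gain:
  fixes \<Delta>S :: "'a \<Rightarrow> 'b::euclidean_space"
  shows "quasi_surely \<P> (\<lambda>\<omega>. orth_proj (N_perp \<P> \<Delta>S) H \<bullet> \<Delta>S \<omega> = H \<bullet> \<Delta>S \<omega>)"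
  unfolding quasi_surely_def
proof
  fix P assume "P \<in> \<P>"
  then have "AE \<omega> in P. \<Delta>S \<omega> \<in> supp_qs \<P> \<Delta>S"
    using supp_qs_least(2)[of \<P> \<Delta>S] by (simp add: quasi_surely_def)
  then show "AE \<omega> in P. orth_proj (N_perp \<P> \<Delta>S) H \<bullet> \<Delta>S \<omega> = H \<bullet> \<Delta>S \<omega>"
  proof eventually_elim
    case (elim \<omega>)
    then have "\<Delta>S \<omega> \<in> N_perp \<P> \<Delta>S" by (simp add: N_perp_def span_base)
    then have "orthogonal (H - orth_proj (N_perp \<P> \<Delta>S) H) (\<Delta>S \<omega>)"
      by (intro orth_proj_works) (simp_all add: N_perp_def)
    then show ?case by (simp add: orthogonal_def inner_diff_left)
  qed
qed

text \<open>A hyperplane is closed, so a gain vanishing quasi-surely forces the support, and with it its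
  span, into the hyperplane orthogonal to \<open>h\<close>.\<close>

lemma N_perp_zero_gain:
  fixes \<Delta>S :: "'a \<Rightarrow> 'b::euclidean_space"
  assumes h: "h \<in> N_perp \<P> \<Delta>S" and zero: "quasi_surely \<P> (\<lambda>\<omega>. h \<bullet> \<Delta>S \<omega> = 0)"
  shows "h = 0"
proof -
  have "supp_qs \<P> \<Delta>S \<subseteq> {x. h \<bullet> x = 0}"
    using zero by (intro supp_qs_least(3) closed_hyperplane) simp
  then have "span (supp_qs \<P> \<Delta>S) \<subseteq> {x. h \<bullet> x = 0}"
    by (intro span_minimal subspace_hyperplane)
  then have "h \<bullet> h = 0" using h by (auto simp: N_perp_def)
  then show ?thesis by simp
qed

lemma strategy_cone_no_losses:
  fixes \<Delta>S :: "'a \<Rightarrow> 'b::euclidean_space"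
  assumes NA: "no_arbitrage \<P> \<Delta>S \<H>" and h: "h \<in> strategy_cone \<P> \<Delta>S \<H>"
    and nonneg: "quasi_surely \<P> (\<lambda>\<omega>. 0 \<le> h \<bullet> \<Delta>S \<omega>)"
  shows "h = 0"
proof -
  let ?p = "orth_proj (N_perp \<P> \<Delta>S)"
  obtain c H where H: "h = c *\<^sub>R ?p H" "H \<in> \<H>" "0 \<le> c"
    using h by (auto simp: strategy_cone_def proj_strategies_def)
  show ?thesis
  proof (cases "c = 0")
    case False
    have "quasi_surely \<P> (\<lambda>\<omega>. 0 \<le> H \<bullet> \<Delta>S \<omega>)"
      unfolding quasi_surely_def
    proof
      fix P assume P: "P \<in> \<P>"
      have "AE \<omega> in P. 0 \<le> h \<bullet> \<Delta>S \<omega>" "AE \<omega> in P. ?p H \<bullet> \<Delta>S \<omega> = H \<bullet> \<Delta>S \<omega>"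
        using P nonneg orth_proj_gain[of \<P> \<Delta>S H] by (auto simp: quasi_surely_def)
      then show "AE \<omega> in P. 0 \<le> H \<bullet> \<Delta>S \<omega>"
        by eventually_elim (use H False in \<open>simp add: zero_le_mult_iff\<close>)
    qed
    then have "quasi_surely \<P> (\<lambda>\<omega>. H \<bullet> \<Delta>S \<omega> = 0)" using NA H by (simp add: no_arbitrage_def)
    then have "quasi_surely \<P> (\<lambda>\<omega>. ?p H \<bullet> \<Delta>S \<omega> = 0)"
      using orth_proj_gain[of \<P> \<Delta>S H] unfolding quasi_surely_def
      by (fastforce elim: eventually_elim2)
    moreover have "?p H \<in> N_perp \<P> \<Delta>S"
      by (intro orth_proj_works) (simp add: N_perp_def)
    ultimately show ?thesis using N_perp_zero_gain H(1) by auto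
  qed (use H in simp)
qed

lemma strategy_cone_scaleR:
  "h \<in> strategy_cone \<P> \<Delta>S \<H> \<Longrightarrow> 0 \<le> c \<Longrightarrow> c *\<^sub>R h \<in> strategy_cone \<P> \<Delta>S \<H>"
  unfolding strategy_cone_def by force

section \<open>The fundamental theorem\<close>

lemma pricing_measures_imp_no_arbitrage:
  fixes \<P> :: "'a::topological_space measure set" and X :: "'a \<Rightarrow> 'b::euclidean_space"
  assumes sets: "\<And>P. P \<in> \<P> \<Longrightarrow> sets P = sets borel" and X: "X \<in> borel_measurable borel"
    and dom: "\<And>P. P \<in> \<P> \<Longrightarrow> \<exists>Q\<in>pricing_measures \<P> X \<H>. absolutely_continuous Q P"
  shows "no_arbitrage \<P> X \<H>"
  unfolding no_arbitrage_def
proof (intro ballI impI quasi_surely_def[THEN iffD2])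
  fix H P
  assume H: "H \<in> \<H>" "quasi_surely \<P> (\<lambda>\<omega>. 0 \<le> H \<bullet> X \<omega>)" and P: "P \<in> \<P>"
  obtain Q R where Q: "absolutely_continuous Q P" "Q \<in> borel_prob_measures"
      "R \<in> \<P>" "absolutely_continuous R Q" "integrable Q (\<lambda>\<omega>. norm (X \<omega>))" "(\<integral>\<omega>. H \<bullet> X \<omega> \<partial>Q) \<le> 0"
    using dom[OF P] H(1) by (auto simp: pricing_measures_def dominated_by_def)
  have sets_Q: "sets Q = sets borel" using Q(2) by (simp add: space_prob_algebra)
  have XQ: "X \<in> borel_measurable Q" using X measurable_cong_sets[OF sets_Q refl] by blast
  have "integrable Q (\<lambda>\<omega>. H \<bullet> X \<omega>)"
    using integrable_norm_cancel[OF Q(5) XQ] by (rule integrable_inner_right)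
  moreover have nonneg: "AE \<omega> in Q. 0 \<le> H \<bullet> X \<omega>"
    using absolutely_continuous_AE[OF _ Q(4)] sets sets_Q Q(3) H(2) by (simp add: quasi_surely_def)
  moreover have "(\<integral>\<omega>. H \<bullet> X \<omega> \<partial>Q) = 0"
    using Q(6) integral_nonneg_AE[OF nonneg] by linarith
  ultimately have "AE \<omega> in Q. H \<bullet> X \<omega> = 0"
    using integral_nonneg_eq_0_iff_AE by blast
  then show "AE \<omega> in P. H \<bullet> X \<omega> = 0"
    using absolutely_continuous_AE[OF _ Q(1)] sets[OF P] sets_Q by simp
qed

lemma no_arbitrage_imp_pricing_measures:
  fixes \<P> :: "'a::topological_space measure set" and X :: "'a \<Rightarrow> 'b::euclidean_space"
  assumes prob: "\<P> \<subseteq> borel_prob_measures" and conv: "convex_measures \<P>"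
    and X: "X \<in> borel_measurable borel"
    and cone: "convex (strategy_cone \<P> X \<H>)" "closed (strategy_cone \<P> X \<H>)"
    and NA: "no_arbitrage \<P> X \<H>" and P: "P \<in> \<P>"
  shows "\<exists>Q\<in>pricing_measures \<P> X \<H>. absolutely_continuous Q P"
proof -
  have sets: "sets R = sets borel" if "R \<in> \<P>" for R using prob that by (auto simp: space_prob_algebra)
  \<comment> \<open>Inserting \<open>0\<close> changes the cone only if there are no strategies at all.\<close>
  define K where "K = insert 0 (strategy_cone \<P> X \<H>)"
  have K: "closed K" "0 \<in> K" "\<And>h c. h \<in> K \<Longrightarrow> 0 \<le> c \<Longrightarrow> c *\<^sub>R h \<in> K"
    using cone(2) by (auto simp: K_def strategy_cone_scaleR)
  have K_add: "h + k \<in> K" if "h \<in> K" "k \<in> K" for h k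
  proof -
    have "h + k \<in> strategy_cone \<P> X \<H>" if "h \<in> strategy_cone \<P> X \<H>" "k \<in> strategy_cone \<P> X \<H>"
    proof -
      have "(1/2) *\<^sub>R h + (1/2) *\<^sub>R k \<in> strategy_cone \<P> X \<H>"
        using cone(1) that by (intro convexD) auto
      from strategy_cone_scaleR[OF this, of 2] show ?thesis by (simp add: scaleR_add_right)
    qed
    then show ?thesis using that by (auto simp: K_def)
  qed
  have lose: "h = 0" if "h \<in> K" "quasi_surely \<P> (\<lambda>\<omega>. 0 \<le> h \<bullet> X \<omega>)" for h
    using that strategy_cone_no_losses[OF NA] by (auto simp: K_def)
  obtain R where R: "R \<in> \<P>" "absolutely_continuous R P"
    and lose_R: "\<And>h. h \<in> K \<Longrightarrow> AE \<omega> in R. 0 \<le> h \<bullet> X \<omega> \<Longrightarrow> h = 0"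
    using single_measure_detecting_losses[OF conv sets K(1,3) lose P] by blast
  interpret R: prob_space R using prob R(1) by (auto simp: space_prob_algebra)
  have XR: "X \<in> borel_measurable R" using X measurable_cong_sets[OF sets[OF R(1)] refl] by blast
  obtain Q where Q: "prob_space Q" "sets Q = sets R" "absolutely_continuous R Q"
      "absolutely_continuous Q R" "integrable Q (\<lambda>\<omega>. norm (X \<omega>))"
    and mean: "\<And>h. h \<in> K \<Longrightarrow> (\<integral>\<omega>. h \<bullet> X \<omega> \<partial>Q) \<le> 0"
    using R.equivalent_pricing_measure[OF XR K K_add lose_R] by blast
  have "(\<integral>\<omega>. H \<bullet> X \<omega> \<partial>Q) \<le> 0" if H: "H \<in> \<H>" for H
  proof -
    let ?h = "orth_proj (N_perp \<P> X) H"
    have "?h = 1 *\<^sub>R ?h" by simp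
    then have "?h \<in> K"
      using H unfolding K_def strategy_cone_def proj_strategies_def
      by (intro insertI2 CollectI exI[of _ 1] exI[of _ ?h]) auto
    have "AE \<omega> in R. ?h \<bullet> X \<omega> = H \<bullet> X \<omega>"
      using orth_proj_gain[of \<P> X H] R(1) by (simp add: quasi_surely_def)
    then have "AE \<omega> in Q. ?h \<bullet> X \<omega> = H \<bullet> X \<omega>"
      by (rule absolutely_continuous_AE[OF Q(2,3)])
    moreover have "X \<in> borel_measurable Q" using XR measurable_cong_sets[OF Q(2) refl] by blast
    ultimately have "(\<integral>\<omega>. H \<bullet> X \<omega> \<partial>Q) = (\<integral>\<omega>. ?h \<bullet> X \<omega> \<partial>Q)"
      by (intro integral_cong_AE) auto
    then show ?thesis using mean[OF \<open>?h \<in> K\<close>] by simp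
  qed
  then have "Q \<in> pricing_measures \<P> X \<H>"
    using Q R(1) sets[OF R(1)]
    by (auto simp: pricing_measures_def dominated_by_def space_prob_algebra)
  then show ?thesis using absolutely_continuous_trans[OF Q(4) R(2)] by blast
qed

theorem theorem2p1:
  fixes \<P> :: "'a::polish_space measure set"
    and S0 :: "real ^ 'd"
    and S1 :: "'a \<Rightarrow> real ^ 'd"
    and \<H> :: "(real ^ 'd) set"
  assumes "\<P> \<subseteq> borel_prob_measures"
    and "convex_measures \<P>"
    and "S1 \<in> borel_measurable borel"
    and "convex (strategy_cone \<P> (price_increment S0 S1) \<H>)"
    and "closed (strategy_cone \<P> (price_increment S0 S1) \<H>)"
  shows "no_arbitrage \<P> (price_increment S0 S1) \<H> \<longleftrightarrow>
    (\<forall>P\<in>\<P>. \<exists>Q\<in>pricing_measures \<P> (price_increment S0 S1) \<H>. absolutely_continuous Q P)"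
proof -
  have X: "price_increment S0 S1 \<in> borel_measurable borel"
    using assms(3) unfolding price_increment_def[abs_def] by measurable
  have "sets P = sets borel" if "P \<in> \<P>" for P
    using assms(1) that by (auto simp: space_prob_algebra)
  then show ?thesis
    using no_arbitrage_imp_pricing_measures[OF assms(1,2) X assms(4,5)]
      pricing_measures_imp_no_arbitrage[OF _ X] by metis
qed

end
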